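(* Let $X$ be an infinite-dimensional complex Hilbert space and let $A\in\mathcal{B}(X)$ be generalized Drazin invertible. Then the following statements hold: (i) $A^{\otimes}=A^{\mathrm{cEP}}P_{R(A^d),\,N(A^{\mathrm{cEP}}A)}$; (ii) $A^{\otimes}=A^dP_{R(A^d),\,N(A^{\mathrm{cEP}}A)}$; (iii) $AA^{\mathrm{cEP}}A$ is group invertible and $A^{\otimes}=(AA^{\mathrm{cEP}}A)^\#=(P_{R(A^d)}A)^\#$; (iv) $A^{\otimes}=(A^2)^{\mathrm{cEP}}AA^{\mathrm{cEP}}A=(A^2)^{\mathrm{cEP}}AP_{R(A^d),\,N(A^{\mathrm{cEP}}A)}$; (v) $A^{\otimes}=(A^d)^2P_{R(A^d)}A$; (vi) $A^{\otimes}=(A^2)^{\mathrm{cEP}}A$; (vii) $A^3A^d$ is group invertible and $A^{\otimes}=(A^3A^d)^{\mathrm{core}}AA^{\mathrm{cEP}}A=(A^3A^d)^{\mathrm{core}}A$.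
   Context: $\mathcal{B}(X)$ is the set of bounded linear operators on $X$; $R(\cdot)$, $N(\cdot)$ denote range and null space; $P_L$ is the orthogonal projector onto a closed subspace $L$; $P_{L,M}$ is the idempotent with range $L$ and null space $M$. $T\in\mathcal{B}(X)$ is generalized Drazin invertible if there is a (necessarily unique) $T^d\in\mathcal{B}(X)$ with $TT^d=T^dT$, $T^dTT^d=T^d$ and $T-T^2T^d$ quasinilpotent; $T$ is group invertible if moreover $T=T^2T^d$, and then $T^\#=T^d$ is its group inverse. The core-EP inverse $T^{\mathrm{cEP}}$ of a generalized Drazin invertible $T$ is the unique (it exists) operator $B\in\mathcal{B}(X)$ with $TB=P_{R(T^d)}$ and $R(B)\subseteq R(T^d)$; if $T$ is group invertible, $T^{\mathrm{cEP}}$ is called the core inverse of $T$ and denoted $T^{\mathrm{core}}$. The weak group inverse of $A$ is $A^{\otimes}=(A^{\mathrm{cEP}})^2A$. *)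

theory Defs
  imports "HOL-Analysis.Analysis"
begin

class complex_vector = real_vector +
  fixes scaleC :: "complex \<Rightarrow> 'a \<Rightarrow> 'a" (infixr "*\<^sub>C" 75)
  assumes scaleC_add_right: "c *\<^sub>C (x + y) = c *\<^sub>C x + c *\<^sub>C y"
    and scaleC_add_left: "(b + c) *\<^sub>C x = b *\<^sub>C x + c *\<^sub>C x"
    and scaleC_scaleC: "b *\<^sub>C (c *\<^sub>C x) = (b * c) *\<^sub>C x"
    and scaleC_one: "1 *\<^sub>C x = x"
    and scaleR_scaleC: "r *\<^sub>R x = complex_of_real r *\<^sub>C x"

lemma vector_space_scaleC:
  "vector_space (scaleC :: complex \<Rightarrow> 'a \<Rightarrow> 'a::complex_vector)"
  by unfold_locales (simp_all add: scaleC_add_right scaleC_add_left scaleC_scaleC scaleC_one)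

(* A complex Banach space whose norm comes from an inner product that is
   linear in the first argument. *)
class complex_hilbert = complex_vector + banach +
  fixes cinner :: "'a \<Rightarrow> 'a \<Rightarrow> complex"
  assumes cinner_add_left: "cinner (x + y) z = cinner x z + cinner y z"
    and cinner_scaleC_left: "cinner (c *\<^sub>C x) y = c * cinner x y"
    and cinner_commute: "cinner x y = cnj (cinner y x)"
    and cinner_norm: "cinner x x = complex_of_real ((norm x)\<^sup>2)"

definition bounded_clinear :: "('a::complex_hilbert \<Rightarrow> 'a) \<Rightarrow> bool" where
  "bounded_clinear T \<longleftrightarrow> bounded_linear T \<and> (\<forall>c x. T (c *\<^sub>C x) = c *\<^sub>C T x)"

definition null_space :: "('a::complex_hilbert \<Rightarrow> 'a) \<Rightarrow> 'a set" where
  "null_space T = {x. T x = 0}"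

definition orth_compl :: "'a::complex_hilbert set \<Rightarrow> 'a set" where
  "orth_compl L = {x. \<forall>y\<in>L. cinner x y = 0}"

definition is_proj_along ::
    "('a::complex_hilbert \<Rightarrow> 'a) \<Rightarrow> 'a set \<Rightarrow> 'a set \<Rightarrow> bool" where
  "is_proj_along P L M \<longleftrightarrow>
     bounded_clinear P \<and> P \<circ> P = P \<and> range P = L \<and> null_space P = M"

(* P_{L,M}; meaningful only if L and M are closed complementary subspaces. *)
definition proj_along :: "'a::complex_hilbert set \<Rightarrow> 'a set \<Rightarrow> 'a \<Rightarrow> 'a" where
  "proj_along L M = (THE P. is_proj_along P L M)"

(* P_L *)
definition orth_proj :: "'a::complex_hilbert set \<Rightarrow> 'a \<Rightarrow> 'a" where
  "orth_proj L = proj_along L (orth_compl L)"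

definition invertible_op :: "('a::complex_hilbert \<Rightarrow> 'a) \<Rightarrow> bool" where
  "invertible_op T \<longleftrightarrow>
     bounded_clinear T \<and> (\<exists>S. bounded_clinear S \<and> T \<circ> S = id \<and> S \<circ> T = id)"

definition spectrum_op :: "('a::complex_hilbert \<Rightarrow> 'a) \<Rightarrow> complex set" where
  "spectrum_op T = {z. \<not> invertible_op (\<lambda>x. T x - z *\<^sub>C x)}"

definition quasinilpotent :: "('a::complex_hilbert \<Rightarrow> 'a) \<Rightarrow> bool" where
  "quasinilpotent T \<longleftrightarrow> bounded_clinear T \<and> spectrum_op T = {0}"

definition is_gD_inverse ::
    "('a::complex_hilbert \<Rightarrow> 'a) \<Rightarrow> ('a \<Rightarrow> 'a) \<Rightarrow> bool" where
  "is_gD_inverse T S \<longleftrightarrow> bounded_clinear T \<and> bounded_clinear S \<and>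
     T \<circ> S = S \<circ> T \<and> S \<circ> T \<circ> S = S \<and>
     quasinilpotent (\<lambda>x. T x - (T \<circ> T \<circ> S) x)"

definition gD_invertible :: "('a::complex_hilbert \<Rightarrow> 'a) \<Rightarrow> bool" where
  "gD_invertible T \<longleftrightarrow> (\<exists>S. is_gD_inverse T S)"

definition gD_inv :: "('a::complex_hilbert \<Rightarrow> 'a) \<Rightarrow> 'a \<Rightarrow> 'a" where
  "gD_inv T = (THE S. is_gD_inverse T S)"

definition group_invertible :: "('a::complex_hilbert \<Rightarrow> 'a) \<Rightarrow> bool" where
  "group_invertible T \<longleftrightarrow> gD_invertible T \<and> T = T \<circ> T \<circ> gD_inv T"

(* Meaningful only for group invertible T. *)
definition group_inv :: "('a::complex_hilbert \<Rightarrow> 'a) \<Rightarrow> 'a \<Rightarrow> 'a" where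
  "group_inv T = gD_inv T"

definition cEP_inv :: "('a::complex_hilbert \<Rightarrow> 'a) \<Rightarrow> 'a \<Rightarrow> 'a" where
  "cEP_inv T = (THE B. bounded_clinear B \<and>
     T \<circ> B = orth_proj (range (gD_inv T)) \<and> range B \<subseteq> range (gD_inv T))"

(* Meaningful only for group invertible T. *)
definition core_inv :: "('a::complex_hilbert \<Rightarrow> 'a) \<Rightarrow> 'a \<Rightarrow> 'a" where
  "core_inv T = cEP_inv T"

definition weak_group_inv :: "('a::complex_hilbert \<Rightarrow> 'a) \<Rightarrow> 'a \<Rightarrow> 'a" where
  "weak_group_inv A = (cEP_inv A ^^ 2) \<circ> A"

end

(* Let D be the generalized Drazin inverse of A and P the orthogonal projector onto R(D).
   Since A B = P and R(B) \<subseteq> R(D) force B = D P, the core-EP inverse is D P, and every item reduces to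
   word identities in A, D, P using A D = D A, D A D = D, P D = D and A D P = P.
   The operators A\<^sup>2 and A\<^sup>3 D both have D\<^sup>2 as generalized Drazin inverse, with the same range as D.

   The analytic input is the uniqueness of the generalized Drazin inverse: for two inverses S, S' of T
   the operator X = T S (1 - T S') satisfies X = S X N with N = T - T\<^sup>2 S' quasinilpotent, and
   Liouville's theorem applied to w \<mapsto> X (1 - w N)\<^sup>-\<^sup>1 gives X = 0; likewise for (1 - T S') T S. *)

theory Submission
  imports Defs "HOL-Complex_Analysis.Complex_Analysis" "HOL-Real_Asymp.Real_Asymp"
begin

section \<open>Inner product identities and the Cauchy-Schwarz inequality\<close>

interpretation scaleC: vector_space "scaleC :: complex \<Rightarrow> 'a \<Rightarrow> 'a::complex_vector"
  by (rule vector_space_scaleC)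

lemma cinner_add_right: "cinner x (y + z) = cinner x y + cinner x z"
  by (metis cinner_commute cinner_add_left complex_cnj_add)

lemma cinner_scaleC_right: "cinner x (c *\<^sub>C y) = cnj c * cinner x y"
  by (metis cinner_commute cinner_scaleC_left complex_cnj_mult)

lemma cinner_minus_left: "cinner (- x) y = - cinner x y"
  using cinner_scaleC_left[of "-1" x y] by simp

lemma cinner_minus_right: "cinner x (- y) = - cinner x y"
  using cinner_scaleC_right[of x "-1" y] by simp

lemma cinner_diff_left: "cinner (x - y) z = cinner x z - cinner y z"
  using cinner_add_left[of x "- y" z] by (simp add: cinner_minus_left)

lemma cinner_diff_right: "cinner x (y - z) = cinner x y - cinner x z"
  using cinner_add_right[of x y "- z"] by (simp add: cinner_minus_right)

lemma cinner_zero_left [simp]: "cinner 0 x = 0"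
  using cinner_diff_left[of x x x] by simp

lemma cinner_zero_right [simp]: "cinner x 0 = 0"
  using cinner_diff_right[of x x x] by simp

lemma cinner_self_eq_0 [simp]: "cinner x x = 0 \<longleftrightarrow> x = 0"
  by (simp add: cinner_norm)

text \<open>The norm is assumed homogeneous for real scalars only; the complex case comes from the
  inner product.\<close>

lemma norm_scaleC: "norm (c *\<^sub>C x) = cmod c * norm (x :: 'a::complex_hilbert)"
proof -
  have "complex_of_real ((norm (c *\<^sub>C x))\<^sup>2) = c * cnj c * complex_of_real ((norm x)\<^sup>2)"
    by (simp only: cinner_norm [symmetric] cinner_scaleC_left cinner_scaleC_right mult_ac)
  also have "\<dots> = complex_of_real ((cmod c * norm x)\<^sup>2)"
    by (simp add: power_mult_distrib flip: complex_norm_square)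
  finally have "(norm (c *\<^sub>C x))\<^sup>2 = (cmod c * norm x)\<^sup>2"
    using of_real_eq_iff by blast
  then show ?thesis
    by (simp add: power2_eq_iff_nonneg)
qed

lemma norm_diff_scaleC_square:
  "(norm (x - c *\<^sub>C y))\<^sup>2 = (norm x)\<^sup>2 - 2 * Re (cnj c * cinner x y) + (cmod c * norm y)\<^sup>2"
proof -
  have "(norm (x - c *\<^sub>C y))\<^sup>2 = Re (cinner (x - c *\<^sub>C y) (x - c *\<^sub>C y))"
    by (simp add: cinner_norm)
  also have "cinner (x - c *\<^sub>C y) (x - c *\<^sub>C y) =
      cinner x x - (cnj c * cinner x y + cnj (cnj c * cinner x y)) + cinner (c *\<^sub>C y) (c *\<^sub>C y)"
    by (simp add: cinner_diff_left cinner_diff_right cinner_scaleC_left cinner_scaleC_right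
        cinner_commute[of y x] algebra_simps)
  also have "Re \<dots> = (norm x)\<^sup>2 - 2 * Re (cnj c * cinner x y) + (cmod c * norm y)\<^sup>2"
    by (simp add: cinner_norm norm_scaleC)
  finally show ?thesis .
qed

text \<open>The subtracted vector is the orthogonal projection of \<open>x\<close> onto the line
  through \<open>y\<close>. The identity yields both Cauchy-Schwarz and orthogonality at a
  minimiser.\<close>

lemma norm_diff_component_square:
  assumes "y \<noteq> 0"
  shows "(norm (x - (cinner x y / complex_of_real ((norm y)\<^sup>2)) *\<^sub>C y))\<^sup>2 =
    (norm x)\<^sup>2 - (cmod (cinner x y))\<^sup>2 / (norm y)\<^sup>2"
proof -
  define n where "n = (norm y)\<^sup>2"
  define a where "a = cinner x y"
  have n: "n > 0" using assms by (simp add: n_def)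
  define c where "c = a / complex_of_real n"
  have expand: "(norm (x - c *\<^sub>C y))\<^sup>2 = (norm x)\<^sup>2 - 2 * Re (cnj c * a) + (cmod c)\<^sup>2 * n"
    by (simp only: norm_diff_scaleC_square power_mult_distrib a_def n_def)
  have "cnj c * a = complex_of_real ((cmod a)\<^sup>2 / n)"
    by (simp only: c_def of_real_divide complex_norm_square complex_cnj_divide) simp
  then have "Re (cnj c * a) = (cmod a)\<^sup>2 / n" by (simp only: Re_complex_of_real)
  moreover have "(cmod c)\<^sup>2 * n = (cmod a)\<^sup>2 / n"
    using n by (simp add: c_def norm_divide power_divide power2_eq_square)
  ultimately have "(norm (x - c *\<^sub>C y))\<^sup>2 = (norm x)\<^sup>2 - (cmod a)\<^sup>2 / n" using expand by linarith
  then show ?thesis by (simp only: a_def n_def c_def)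
qed

text \<open>Removing the component of \<open>x\<close> along \<open>y\<close> lowers the squared
  norm by a multiple of \<open>(cmod (cinner x y))^2\<close>; minimality makes that term
  vanish.\<close>

lemma cinner_eq_0_if_minimal:
  assumes "\<And>c. norm x \<le> norm (x - c *\<^sub>C y)"
  shows "cinner x y = 0"
proof (cases "y = 0")
  case False
  then have "(norm x)\<^sup>2 \<le> (norm x)\<^sup>2 - (cmod (cinner x y))\<^sup>2 / (norm y)\<^sup>2"
    unfolding norm_diff_component_square [OF False, symmetric]
    by (intro power_mono assms norm_ge_zero)
  then have "(cmod (cinner x y))\<^sup>2 \<le> 0" using False by (simp add: divide_le_0_iff)
  then show ?thesis by simp
qed simp

lemma cinner_norm_le: "cmod (cinner x y) \<le> norm x * norm y"
proof (cases "y = 0")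
  case False
  have "0 \<le> (norm x)\<^sup>2 - (cmod (cinner x y))\<^sup>2 / (norm y)\<^sup>2"
    unfolding norm_diff_component_square [OF False, symmetric] by simp
  then have "(cmod (cinner x y))\<^sup>2 \<le> (norm x * norm y)\<^sup>2"
    using False by (simp add: power_mult_distrib pos_divide_le_eq)
  then show ?thesis by (simp add: power2_le_iff_abs_le)
qed simp

lemma parallelogram_law:
  fixes x y :: "'a::complex_hilbert"
  shows "(norm (x + y))\<^sup>2 + (norm (x - y))\<^sup>2 = 2 * (norm x)\<^sup>2 + 2 * (norm y)\<^sup>2"
  using norm_diff_scaleC_square[of x 1 y] norm_diff_scaleC_square[of x "-1" y] by simp

section \<open>Bounded complex-linear operators\<close>

lemma bounded_clinearD:
  assumes "bounded_clinear T"
  shows bounded_clinear_bounded_linear: "bounded_linear T"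
    and bounded_clinear_add: "T (x + y) = T x + T y"
    and bounded_clinear_diff: "T (x - y) = T x - T y"
    and bounded_clinear_minus: "T (- x) = - T x"
    and bounded_clinear_zero: "T 0 = 0"
    and bounded_clinear_scaleC: "T (c *\<^sub>C x) = c *\<^sub>C T x"
  using assms unfolding bounded_clinear_def
  by (auto simp: linear_simps)

lemma bounded_clinear_pos_bounded:
  assumes "bounded_clinear T"
  obtains K where "0 < K" "\<And>x. norm (T x) \<le> norm x * K"
  using bounded_linear.pos_bounded[OF bounded_clinear_bounded_linear[OF assms]] by blast

lemma bounded_clinear_id: "bounded_clinear (\<lambda>x. x)"
  by (simp add: bounded_clinear_def)

lemma bounded_clinear_const_zero: "bounded_clinear (\<lambda>x. 0)"
  by (simp add: bounded_clinear_def)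

lemma bounded_clinear_comp:
  "bounded_clinear S \<Longrightarrow> bounded_clinear T \<Longrightarrow> bounded_clinear (\<lambda>x. S (T x))"
  by (simp add: bounded_clinear_def bounded_linear_compose)

lemma bounded_clinear_sub:
  "bounded_clinear S \<Longrightarrow> bounded_clinear T \<Longrightarrow> bounded_clinear (\<lambda>x. S x - T x)"
  by (simp add: bounded_clinear_def bounded_linear_sub scaleC.scale_right_diff_distrib)

lemma bounded_clinear_scaleC_const: "bounded_clinear (\<lambda>x. c *\<^sub>C x)"
proof -
  have "bounded_linear (\<lambda>x::'a. c *\<^sub>C x)"
    by (rule bounded_linear_intro[where K = "cmod c"])
      (simp_all add: norm_scaleC mult.commute scaleR_scaleC scaleC_add_right)
  then show ?thesis by (simp add: bounded_clinear_def mult.commute)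
qed

section \<open>Orthogonal projectors onto closed subspaces\<close>

text \<open>A minimising sequence is Cauchy by the parallelogram law, so the distance to a closed
  subspace is attained; the difference to a minimiser is orthogonal to the subspace.\<close>

lemma orthogonal_decomposition:
  fixes L :: "'a::complex_hilbert set"
  assumes L: "scaleC.subspace L" "closed L"
  obtains p where "p \<in> L" "x - p \<in> orth_compl L"
proof -
  define d where "d = (INF l\<in>L. norm (x - l))"
  have bdd: "bdd_below ((\<lambda>l. norm (x - l)) ` L)" by (rule bdd_belowI2[where m = 0]) simp
  have ne: "L \<noteq> {}" using L(1) scaleC.subspace_0 by blast
  have d_le: "d \<le> norm (x - l)" if "l \<in> L" for l
    unfolding d_def using bdd that by (rule cINF_lower)
  have d0: "0 \<le> d" unfolding d_def using ne by (intro cINF_greatest) auto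
  have "\<exists>l\<in>L. norm (x - l) < d + 1 / real (Suc n)" for n
    using cINF_less_iff[OF ne bdd, of "d + 1 / real (Suc n)"] by (simp add: d_def)
  then obtain s where sL: "\<And>n. s n \<in> L" and s: "\<And>n. norm (x - s n) < d + 1 / real (Suc n)"
    by metis
  \<comment> \<open>The midpoint of \<open>a\<close> and \<open>b\<close> lies in \<open>L\<close>,
    hence has distance at least \<open>d\<close> from \<open>x\<close>; the parallelogram law for
    \<open>x - a\<close> and \<open>x - b\<close> turns this into the bound.\<close>
  have mid: "(norm (a - b))\<^sup>2 \<le> 2 * (norm (x - a))\<^sup>2 + 2 * (norm (x - b))\<^sup>2 - 4 * d\<^sup>2"
    if "a \<in> L" "b \<in> L" for a b
  proof -
    have "(1/2) *\<^sub>C (a + b) \<in> L"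
      using L(1) that by (simp add: scaleC.subspace_add scaleC.subspace_scale)
    then have "2 * d \<le> 2 * norm (x - (1/2) *\<^sub>C (a + b))" using d_le by simp
    also have "\<dots> = norm (2 *\<^sub>C (x - (1/2) *\<^sub>C (a + b)))" by (simp add: norm_scaleC)
    also have "2 *\<^sub>C (x - (1/2) *\<^sub>C (a + b)) = 2 *\<^sub>C x - (a + b)"
      by (simp add: scaleC.scale_right_diff_distrib)
    also have "2 *\<^sub>C x = x + x"
      using scaleC_add_left[of 1 1 x] by (simp add: scaleC_one)
    finally have "2 * d \<le> norm ((x - a) + (x - b))" by (simp add: algebra_simps)
    then have "(2 * d)\<^sup>2 \<le> (norm ((x - a) + (x - b)))\<^sup>2" using d0 by (intro power_mono) auto
    moreover have "norm ((x - a) - (x - b)) = norm (a - b)" by (simp add: norm_minus_commute)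
    ultimately show ?thesis using parallelogram_law[of "x - a" "x - b"] by (simp add: power_mult_distrib)
  qed
  \<comment> \<open>With \<open>e = 1 / Suc N\<close> one has \<open>e * e \<le> e\<close>, so each
    squared distance exceeds \<open>d^2\<close> by at most \<open>(2 * d + 1) * e\<close>;
    \<open>mid\<close> multiplies this excess by 4.\<close>
  have bound: "(norm (s m - s n))\<^sup>2 \<le> (8 * d + 4) / real (Suc N)" if "m \<ge> N" "n \<ge> N" for m n N
  proof -
    define e where "e = 1 / real (Suc N)"
    have e: "0 \<le> e" "e \<le> 1" by (auto simp: e_def)
    have *: "(norm (x - s k))\<^sup>2 \<le> d\<^sup>2 + (2 * d + 1) * e" if "k \<ge> N" for k
    proof -
      have "1 / real (Suc k) \<le> e" unfolding e_def using that by (simp add: frac_le)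
      then have "norm (x - s k) \<le> d + e" using s[of k] by simp
      then have "(norm (x - s k))\<^sup>2 \<le> (d + e)\<^sup>2" by (simp add: power_mono)
      also have "\<dots> = d\<^sup>2 + 2 * d * e + e * e" by (simp add: power2_eq_square algebra_simps)
      also have "\<dots> \<le> d\<^sup>2 + 2 * d * e + 1 * e" using e by (intro add_mono mult_right_mono order_refl)
      finally show ?thesis by (simp add: algebra_simps)
    qed
    have "(norm (s m - s n))\<^sup>2 \<le> 4 * ((2 * d + 1) * e)"
      using mid[OF sL sL, of m n] *[OF that(1)] *[OF that(2)] by simp
    then show ?thesis by (simp add: e_def field_simps)
  qed
  have "Cauchy s"
  proof (rule metric_CauchyI)
    fix e :: real assume "0 < e"
    have "(\<lambda>N. (8 * d + 4) / real (Suc N)) \<longlonglongrightarrow> 0" by real_asymp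
    then have "eventually (\<lambda>N. (8 * d + 4) / real (Suc N) < e\<^sup>2) sequentially"
      using \<open>0 < e\<close> by (intro order_tendstoD(2)) auto
    then obtain N where N: "(8 * d + 4) / real (Suc N) < e\<^sup>2"
      unfolding eventually_sequentially by blast
    have "norm (s m - s n) < e" if "m \<ge> N" "n \<ge> N" for m n
      using le_less_trans[OF bound[OF that] N] \<open>0 < e\<close> by (rule power_less_imp_less_base[OF _ less_imp_le])
    then show "\<exists>M. \<forall>m\<ge>M. \<forall>n\<ge>M. dist (s m) (s n) < e" unfolding dist_norm by blast
  qed
  then obtain p where p: "s \<longlonglongrightarrow> p" unfolding Cauchy_convergent_iff convergent_def by blast
  have pL: "p \<in> L" using L(2) p sL closed_sequentially by blast
  have "norm (x - p) \<le> d"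
  proof (rule tendsto_le[OF sequentially_bot])
    show "(\<lambda>n. norm (x - s n)) \<longlonglongrightarrow> norm (x - p)" by (intro tendsto_intros p)
    show "(\<lambda>n. d + 1 / real (Suc n)) \<longlonglongrightarrow> d" by real_asymp
    show "eventually (\<lambda>n. norm (x - s n) \<le> d + 1 / real (Suc n)) sequentially"
      using s by (simp add: less_imp_le)
  qed
  moreover have "d \<le> norm (x - p - c *\<^sub>C y)" if "y \<in> L" for y c
    using d_le[of "p + c *\<^sub>C y", OF scaleC.subspace_add[OF L(1) pL scaleC.subspace_scale[OF L(1) that]]]
    by (simp only: diff_diff_eq)
  ultimately have "cinner (x - p) y = 0" if "y \<in> L" for y
    using that by (intro cinner_eq_0_if_minimal) (rule order_trans)
  then have "x - p \<in> orth_compl L" by (simp add: orth_compl_def)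
  with pL show ?thesis by (rule that)
qed

text \<open>\<open>Q\<close> fixes \<open>P x\<close>, which lies in the common range, and kills
  \<open>x - P x\<close>, which lies in the common null space. This justifies the definite
  description in \<open>proj_along\<close>.\<close>

lemma is_proj_along_unique:
  assumes "is_proj_along P L M" "is_proj_along Q L M"
  shows "P = Q"
proof
  fix x
  have P: "bounded_clinear P" "\<And>x. P (P x) = P x" "range P = L" "null_space P = M"
    and Q: "bounded_clinear Q" "\<And>x. Q (Q x) = Q x" "range Q = L" "null_space Q = M"
    using assms by (auto simp: is_proj_along_def fun_eq_iff)
  obtain y where "P x = Q y" using P(3) Q(3) by (metis rangeE rangeI)
  then have "Q (P x) = P x" using Q(2) by simp
  moreover have "x - P x \<in> null_space P"
    using P(2) by (simp add: null_space_def bounded_clinear_diff[OF P(1)])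
  then have "Q (x - P x) = 0" using P(4) Q(4) by (auto simp: null_space_def)
  ultimately show "P x = Q x" by (simp add: bounded_clinear_diff[OF Q(1)])
qed

lemma proj_along_eq: "is_proj_along P L M \<Longrightarrow> proj_along L M = P"
  unfolding proj_along_def by (rule the_equality) (auto intro: is_proj_along_unique)

text \<open>A vector in both \<open>L\<close> and \<open>orth_compl L\<close> is orthogonal to
  itself, so the decomposition is unique. Uniqueness makes the chosen component linear in
  \<open>x\<close>, and Pythagoras bounds it by \<open>norm x\<close>.\<close>

lemma is_proj_along_orth_proj:
  fixes L :: "'a::complex_hilbert set"
  assumes L: "scaleC.subspace L" "closed L"
  shows "is_proj_along (orth_proj L) L (orth_compl L)"
proof -
  have "\<exists>p\<in>L. x - p \<in> orth_compl L" for x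
    using orthogonal_decomposition[OF L] by blast
  then obtain P where P: "\<And>x. P x \<in> L" "\<And>x. x - P x \<in> orth_compl L"
    by metis
  have orth: "scaleC.subspace (orth_compl L)"
    by (rule scaleC.subspaceI) (simp_all add: orth_compl_def cinner_add_left cinner_scaleC_left)
  have uniq: "P x = p" if "p \<in> L" "x - p \<in> orth_compl L" for x p
  proof -
    have "P x - p \<in> L" using P(1) that(1) L(1) scaleC.subspace_diff by blast
    moreover have "P x - p \<in> orth_compl L"
      using scaleC.subspace_diff[OF orth that(2) P(2)[of x]] by simp
    ultimately have "cinner (P x - p) (P x - p) = 0" by (simp add: orth_compl_def)
    then show ?thesis by simp
  qed
  have add: "P (x + y) = P x + P y" for x y
    using scaleC.subspace_add[OF orth P(2)[of x] P(2)[of y]] L(1) P(1)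
    by (intro uniq) (auto simp: scaleC.subspace_add algebra_simps)
  have scale: "P (c *\<^sub>C x) = c *\<^sub>C P x" for c x
    using scaleC.subspace_scale[OF orth P(2)[of x], of c] L(1) P(1)
    by (intro uniq) (auto simp: scaleC.subspace_scale scaleC.scale_right_diff_distrib)
  have le: "norm (P x) \<le> norm x" for x
  proof -
    have "cinner (x - P x) (P x) = 0" using P by (simp add: orth_compl_def)
    then have "(norm x)\<^sup>2 = (norm (x - P x))\<^sup>2 + (norm (P x))\<^sup>2"
      using norm_diff_scaleC_square[of "x - P x" "-1" "P x"] by simp
    then have "(norm (P x))\<^sup>2 \<le> (norm x)\<^sup>2" by simp
    then show ?thesis by simp
  qed
  have "bounded_linear P"
    by (rule bounded_linear_intro[where K = 1]) (simp_all add: add scale scaleR_scaleC le)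
  then have "bounded_clinear P" by (simp add: bounded_clinear_def scale)
  moreover have fix_L: "P x = x" if "x \<in> L" for x
    using that orth by (intro uniq) (auto simp: scaleC.subspace_0)
  moreover have "range P = L"
    using P(1) fix_L by (auto simp: image_iff) (metis)
  moreover have "P x = 0 \<longleftrightarrow> x \<in> orth_compl L" for x
    using P(2)[of x] uniq[of 0 x] L(1) scaleC.subspace_0 by force
  ultimately have "is_proj_along P L (orth_compl L)"
    using P(1) by (auto simp: is_proj_along_def null_space_def fun_eq_iff)
  then show ?thesis by (simp add: orth_proj_def proj_along_eq)
qed

section \<open>Resolvents of quasinilpotent operators and Liouville's theorem\<close>

lemma invertible_op_iff:
  "invertible_op T \<longleftrightarrow>
    bounded_clinear T \<and> (\<exists>S. bounded_clinear S \<and> (\<forall>x. T (S x) = x) \<and> (\<forall>x. S (T x) = x))"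
  by (simp add: invertible_op_def fun_eq_iff)

text \<open>\<open>R w\<close> is the inverse of \<open>1 - w N\<close>. For
  \<open>w \<noteq> 0\<close> this operator is \<open>-w (N - 1/w)\<close>, and \<open>1/w\<close>
  lies outside the spectrum, so the family is defined on the whole plane.\<close>

lemma quasinilpotent_resolvent:
  fixes N :: "'a::complex_hilbert \<Rightarrow> 'a"
  assumes "quasinilpotent N"
  obtains R where "\<And>w. bounded_clinear (R w)" "\<And>w x. R w (x - w *\<^sub>C N x) = x"
    "\<And>w x. R w x - w *\<^sub>C N (R w x) = x"
proof -
  have N: "bounded_clinear N" and spec: "spectrum_op N = {0}"
    using assms by (auto simp: quasinilpotent_def)
  have "\<exists>R. bounded_clinear R \<and> (\<forall>x. R (x - w *\<^sub>C N x) = x) \<and> (\<forall>x. R x - w *\<^sub>C N (R x) = x)" for w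
  proof (cases "w = 0")
    case True
    then show ?thesis by (intro exI[of _ "\<lambda>x. x"]) (simp add: bounded_clinear_id)
  next
    case False
    have "1 / w \<notin> spectrum_op N" using spec False by simp
    then have "invertible_op (\<lambda>x. N x - (1 / w) *\<^sub>C x)"
      by (simp add: spectrum_op_def)
    then obtain Q where Q: "bounded_clinear Q" "\<And>x. N (Q x) - (1 / w) *\<^sub>C Q x = x"
      "\<And>x. Q (N x - (1 / w) *\<^sub>C x) = x"
      unfolding invertible_op_iff by blast
    define R where "R = (\<lambda>x. (- 1 / w) *\<^sub>C Q x)"
    have "bounded_clinear R"
      unfolding R_def by (rule bounded_clinear_comp[OF bounded_clinear_scaleC_const Q(1)])
    moreover have "R (x - w *\<^sub>C N x) = x" for x
    proof -
      have "R (x - w *\<^sub>C N x) = Q ((- 1 / w) *\<^sub>C (x - w *\<^sub>C N x))"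
        by (simp only: R_def bounded_clinear_scaleC[OF Q(1)])
      also have "(- 1 / w) *\<^sub>C (x - w *\<^sub>C N x) = N x - (1 / w) *\<^sub>C x"
        using False by (simp add: scaleC.scale_right_diff_distrib)
      finally show ?thesis by (simp add: Q)
    qed
    moreover have "R x - w *\<^sub>C N (R x) = x" for x
      using Q(2)[of x] False
      by (simp add: R_def bounded_clinear_minus[OF N] bounded_clinear_scaleC[OF N])
    ultimately show ?thesis by blast
  qed
  then show ?thesis using that by metis
qed

text \<open>Testing against \<open>v\<close> reduces operator-valued holomorphy to the scalar case.
  The resolvent identity reduces differentiability to continuity of
  \<open>w \<mapsto> R w x\<close>.\<close>

lemma resolvent_holomorphic:
  fixes N C :: "'a::complex_hilbert \<Rightarrow> 'a"
  assumes N: "bounded_clinear N" and C: "bounded_clinear C" and R: "\<And>w. bounded_clinear (R w)"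
    and RI: "\<And>w x. R w (x - w *\<^sub>C N x) = x" and IR: "\<And>w x. R w x - w *\<^sub>C N (R w x) = x"
  shows "(\<lambda>w. cinner (C (R w u)) v) holomorphic_on UNIV"
proof -
  have resolvent_eq: "R w x - R z x = (w - z) *\<^sub>C R w (N (R z x))" for w z x
  proof -
    have "R w x = R w (R z x - w *\<^sub>C N (R z x) + (w - z) *\<^sub>C N (R z x))"
      using IR[of z x] by (simp add: scaleC.scale_left_diff_distrib)
    also have "\<dots> = R z x + (w - z) *\<^sub>C R w (N (R z x))"
      by (simp only: bounded_clinear_add[OF R] RI bounded_clinear_scaleC[OF R])
    finally show ?thesis by simp
  qed
  have cont: "((\<lambda>w. R w x) \<longlongrightarrow> R z x) (at z)" for x z
  proof -
    obtain K where K: "0 < K" "\<And>x. norm (R z x) \<le> norm x * K"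
      using bounded_linear.pos_bounded[OF bounded_clinear_bounded_linear[OF R]] by blast
    obtain M where M: "0 < M" "\<And>x. norm (N x) \<le> norm x * M"
      using bounded_linear.pos_bounded[OF bounded_clinear_bounded_linear[OF N]] by blast
    \<comment> \<open>The resolvent identity bounds \<open>R w y\<close> by a term containing
      \<open>R w y\<close> itself; near \<open>z\<close> that term is at most half of the left side
      and can be absorbed, giving a bound uniform in \<open>w\<close>.\<close>
    have local_bound: "norm (R w y) \<le> 2 * K * norm y" if w: "cmod (w - z) * (K * M) < 1 / 2" for w y
    proof -
      have "R z y - R w y = (z - w) *\<^sub>C R z (N (R w y))" by (rule resolvent_eq)
      then have "R w y = R z y + (w - z) *\<^sub>C R z (N (R w y))"
        by (simp add: scaleC.scale_left_diff_distrib algebra_simps)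
      then have "norm (R w y) \<le> norm (R z y) + cmod (w - z) * norm (R z (N (R w y)))"
        by (metis norm_triangle_ineq norm_scaleC)
      also have "\<dots> \<le> norm y * K + cmod (w - z) * (norm (R w y) * M * K)"
        using K M by (intro add_mono mult_left_mono order_trans[OF K(2)] mult_right_mono) auto
      also have "\<dots> = norm y * K + norm (R w y) * (cmod (w - z) * (K * M))" by simp
      also have "\<dots> \<le> norm y * K + norm (R w y) * (1 / 2)"
        using w by (intro add_mono mult_left_mono) auto
      finally show ?thesis by (simp add: algebra_simps)
    qed
    have "((\<lambda>w. cmod (w - z) * (K * M)) \<longlongrightarrow> cmod (z - z) * (K * M)) (at z)" by (intro tendsto_intros)
    then have small: "eventually (\<lambda>w. cmod (w - z) * (K * M) < 1 / 2) (at z)"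
      by (intro order_tendstoD(2)) auto
    have "((\<lambda>w. R w x - R z x) \<longlongrightarrow> 0) (at z)"
    proof (rule Lim_null_comparison)
      show "eventually (\<lambda>w. norm (R w x - R z x) \<le> cmod (w - z) * (2 * K * norm (N (R z x)))) (at z)"
        using small
      proof eventually_elim
        case (elim w)
        show ?case
          unfolding resolvent_eq norm_scaleC by (intro mult_left_mono local_bound elim) auto
      qed
      have "((\<lambda>w. cmod (w - z) * (2 * K * norm (N (R z x)))) \<longlongrightarrow> cmod (z - z) * (2 * K * norm (N (R z x)))) (at z)"
        by (intro tendsto_intros)
      then show "((\<lambda>w. cmod (w - z) * (2 * K * norm (N (R z x)))) \<longlongrightarrow> 0) (at z)" by simp
    qed
    then show ?thesis using Lim_null by blast
  qed
  have contf: "((\<lambda>w. cinner (C (R w x)) v) \<longlongrightarrow> cinner (C (R z x)) v) (at z)" for x z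
  proof -
    have "((\<lambda>w. C (R w x)) \<longlongrightarrow> C (R z x)) (at z)"
      by (rule bounded_linear.tendsto[OF bounded_clinear_bounded_linear[OF C] cont])
    then have "((\<lambda>w. norm (C (R w x) - C (R z x)) * norm v) \<longlongrightarrow> norm (C (R z x) - C (R z x)) * norm v) (at z)"
      by (intro tendsto_intros)
    then have "((\<lambda>w. cinner (C (R w x)) v - cinner (C (R z x)) v) \<longlongrightarrow> 0) (at z)"
      unfolding cinner_diff_left [symmetric] diff_self norm_zero mult_zero_left
      by (rule Lim_null_comparison[OF always_eventually[OF allI[OF cinner_norm_le]]])
    then show ?thesis using Lim_null by blast
  qed
  have "((\<lambda>w. cinner (C (R w u)) v) has_field_derivative cinner (C (R z (N (R z u)))) v) (at z)" for z
    unfolding has_field_derivative_iff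
  \<comment> \<open>For \<open>w \<noteq> z\<close> the difference quotient is
    \<open>cinner (C (R w (N (R z u)))) v\<close>, which converges by \<open>contf\<close>.\<close>
  proof (rule Lim_transform_eventually[OF contf])
    have "(cinner (C (R w u)) v - cinner (C (R z u)) v) / (w - z) = cinner (C (R w (N (R z u)))) v"
      if "w \<noteq> z" for w
    proof -
      have "cinner (C (R w u)) v - cinner (C (R z u)) v = cinner (C (R w u - R z u)) v"
        by (simp only: cinner_diff_left bounded_clinear_diff[OF C])
      also have "\<dots> = (w - z) * cinner (C (R w (N (R z u)))) v"
        by (simp add: resolvent_eq bounded_clinear_scaleC[OF C] cinner_scaleC_left)
      finally show ?thesis using that by simp
    qed
    then show "eventually (\<lambda>w. cinner (C (R w (N (R z u)))) v =
        (cinner (C (R w u)) v - cinner (C (R z u)) v) / (w - z)) (at z)"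
      by (auto simp: eventually_at_filter)
  qed
  then show ?thesis by (auto simp: holomorphic_on_def field_differentiable_def)
qed

text \<open>The bound tends to 0 as \<open>cmod w\<close> grows, so Liouville's theorem applies
  although nothing is assumed on the disc of radius \<open>K\<close>.\<close>

lemma entire_decay_imp_zero:
  assumes f: "f holomorphic_on UNIV" and b: "\<And>w. K < cmod w \<Longrightarrow> cmod (f w) \<le> M / (cmod w - K)"
  shows "f z = 0"
proof (rule Liouville_weak[OF f])
  show "(f \<longlongrightarrow> 0) at_infinity"
  proof (rule Lim_null_comparison)
    show "eventually (\<lambda>w. norm (f w) \<le> M / (cmod w - K)) at_infinity"
      unfolding eventually_at_infinity using b by (intro exI[of _ "K + 1"]) auto
    have "((\<lambda>r. M / (r - K)) \<longlongrightarrow> 0) at_top" by real_asymp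
    then show "((\<lambda>w. M / (cmod w - K)) \<longlongrightarrow> 0) at_infinity"
      by (rule filterlim_compose[OF _ filterlim_norm_at_top])
  qed
qed

text \<open>With \<open>R w = (1 - w N)\<^sup>-\<^sup>1\<close>, the function \<open>X R w\<close> is entire, and
  \<open>(S - w) X R w = S X\<close> makes it vanish at infinity. In the mirrored case
  \<open>X = N X S\<close> one has \<open>R w X (S - w) = X S\<close>, so \<open>S - w\<close> must be onto for large \<open>w\<close>.\<close>

lemma intertwiner_eq_0_left:
  fixes N :: "'a::complex_hilbert \<Rightarrow> 'a"
  assumes q: "quasinilpotent N" and S: "bounded_clinear S" and X: "bounded_clinear X"
    and XS: "\<And>x. X x = S (X (N x))"
  shows "X u = 0"
proof -
  obtain R where R: "\<And>w. bounded_clinear (R w)" "\<And>w x. R w (x - w *\<^sub>C N x) = x"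
    "\<And>w x. R w x - w *\<^sub>C N (R w x) = x" using quasinilpotent_resolvent[OF q] by blast
  have N: "bounded_clinear N" using q by (simp add: quasinilpotent_def)
  obtain K where K: "0 < K" "\<And>x. norm (S x) \<le> norm x * K"
    by (rule bounded_clinear_pos_bounded[OF S]) blast
  have bnd: "norm (X (R w u)) \<le> norm (S (X u)) / (cmod w - K)" if "K < cmod w" for w
  proof -
    define y where "y = R w u"
    have "u = y - w *\<^sub>C N y" by (simp add: y_def R)
    then have "S (X u) = S (X y) - w *\<^sub>C S (X (N y))"
      by (simp add: bounded_clinear_diff[OF S] bounded_clinear_diff[OF X]
          bounded_clinear_scaleC[OF S] bounded_clinear_scaleC[OF X])
    then have "w *\<^sub>C X y = S (X y) - S (X u)" using XS[of y] by simp
    then have "cmod w * norm (X y) \<le> norm (S (X y)) + norm (S (X u))"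
      by (metis norm_scaleC norm_triangle_ineq4)
    then have "norm (X y) * (cmod w - K) \<le> norm (S (X u))"
      using K(2)[of "X y"] by (simp add: algebra_simps)
    then show ?thesis using that by (simp add: y_def pos_le_divide_eq)
  qed
  have "cinner (X (R 0 u)) v = 0" for v
  proof (rule entire_decay_imp_zero[where f = "\<lambda>w. cinner (X (R w u)) v"])
    show "(\<lambda>w. cinner (X (R w u)) v) holomorphic_on UNIV"
      by (rule resolvent_holomorphic[OF N X R])
    show "cmod (cinner (X (R w u)) v) \<le> (norm (S (X u)) * norm v) / (cmod w - K)"
      if "K < cmod w" for w
      using order_trans[OF cinner_norm_le mult_right_mono[OF bnd[OF that] norm_ge_zero]] by simp
  qed
  \<comment> \<open>\<open>R 0\<close> is the identity, and testing with \<open>X u\<close> itself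
    gives \<open>cinner (X u) (X u) = 0\<close>.\<close>
  from this[of "X u"] show ?thesis using R(2)[of 0 u] by simp
qed

text \<open>The equation for \<open>y\<close> is the fixed point equation
  \<open>y = (S y - u) / w\<close>, whose right side is a contraction with constant
  \<open>K / cmod w < 1\<close>.\<close>

lemma surj_shift_large:
  fixes S :: "'a::complex_hilbert \<Rightarrow> 'a"
  assumes S: "bounded_clinear S" and K: "0 < K" "\<And>x. norm (S x) \<le> norm x * K" and w: "K < cmod w"
  obtains y where "u = S y - w *\<^sub>C y" "norm y \<le> norm u / (cmod w - K)"
proof -
  have w0: "w \<noteq> 0" using K(1) w by auto
  define f where "f y = (1 / w) *\<^sub>C (S y - u)" for y
  have "\<exists>!y. f y = y"
  proof (rule banach_fix_type)
    show "0 \<le> K / cmod w" "K / cmod w < 1" using K(1) w w0 by (auto simp: pos_divide_less_eq)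
    show "\<forall>x y. dist (f x) (f y) \<le> K / cmod w * dist x y"
    proof (intro allI)
      fix x y :: 'a
      have "f x - f y = (1 / w) *\<^sub>C S (x - y)"
        by (simp only: f_def bounded_clinear_diff[OF S] scaleC.scale_right_diff_distrib) simp
      then have "dist (f x) (f y) = norm (S (x - y)) / cmod w"
        by (simp add: dist_norm norm_scaleC norm_divide)
      also have "\<dots> \<le> norm (x - y) * K / cmod w" by (intro divide_right_mono K) simp
      finally show "dist (f x) (f y) \<le> K / cmod w * dist x y" by (simp add: dist_norm mult.commute)
    qed
  qed
  then obtain y where "f y = y" by blast
  moreover have "w *\<^sub>C f y = S y - u" using w0 by (simp add: f_def scaleC_one)
  ultimately have "w *\<^sub>C y = S y - u" by simp
  then have u: "u = S y - w *\<^sub>C y" by simp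
  have "cmod w * norm y \<le> norm (S y) + norm u"
    using \<open>w *\<^sub>C y = S y - u\<close> by (metis norm_scaleC norm_triangle_ineq4)
  then have "norm y * (cmod w - K) \<le> norm u" using K(2)[of y] by (simp add: algebra_simps)
  then have "norm y \<le> norm u / (cmod w - K)" using w by (simp add: pos_le_divide_eq)
  with u show ?thesis by (rule that)
qed

lemma intertwiner_eq_0_right:
  fixes N :: "'a::complex_hilbert \<Rightarrow> 'a"
  assumes q: "quasinilpotent N" and S: "bounded_clinear S" and X: "bounded_clinear X"
    and XS: "\<And>x. X x = N (X (S x))"
  shows "X u = 0"
proof -
  obtain R where R: "\<And>w. bounded_clinear (R w)" "\<And>w x. R w (x - w *\<^sub>C N x) = x"
    "\<And>w x. R w x - w *\<^sub>C N (R w x) = x" using quasinilpotent_resolvent[OF q] by blast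
  have N: "bounded_clinear N" using q by (simp add: quasinilpotent_def)
  obtain K where K: "0 < K" "\<And>x. norm (S x) \<le> norm x * K"
    by (rule bounded_clinear_pos_bounded[OF S]) blast
  have XSb: "bounded_clinear (\<lambda>x. X (S x))" by (rule bounded_clinear_comp[OF X S])
  obtain J where J: "0 < J" "\<And>x. norm (X (S x)) \<le> norm x * J"
    by (rule bounded_clinear_pos_bounded[OF XSb]) blast
  have bnd: "norm (R w (X u)) \<le> norm u * J / (cmod w - K)" if w: "K < cmod w" for w
  proof -
    obtain y where y: "u = S y - w *\<^sub>C y" "norm y \<le> norm u / (cmod w - K)"
      by (rule surj_shift_large[OF S K w])
    \<comment> \<open>This reads \<open>X u = (1 - w N) X S y\<close>, so applying
      \<open>R w\<close> leaves \<open>X S y\<close>, which is bounded through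
      \<open>y\<close>.\<close>
    have "X u = X (S y) - w *\<^sub>C N (X (S y))"
      unfolding y(1) bounded_clinear_diff[OF X] bounded_clinear_scaleC[OF X] using XS[of y] by simp
    then have "norm (R w (X u)) = norm (X (S y))" by (simp add: R)
    also have "\<dots> \<le> norm u / (cmod w - K) * J"
      using J y(2) by (meson order_trans mult_right_mono less_imp_le)
    finally show ?thesis by simp
  qed
  have "cinner (R 0 (X u)) v = 0" for v
  proof (rule entire_decay_imp_zero[where f = "\<lambda>w. cinner (R w (X u)) v"])
    show "(\<lambda>w. cinner (R w (X u)) v) holomorphic_on UNIV"
      using resolvent_holomorphic[OF N bounded_clinear_id R] .
    show "cmod (cinner (R w (X u)) v) \<le> (norm u * J * norm v) / (cmod w - K)"
      if "K < cmod w" for w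
      using order_trans[OF cinner_norm_le mult_right_mono[OF bnd[OF that] norm_ge_zero]] by simp
  qed
  from this[of "X u"] show ?thesis using R(2)[of 0 "X u"] by simp
qed

section \<open>Uniqueness of the generalized Drazin inverse\<close>

text \<open>The equations are oriented as rewrite rules: \<open>T\<close> moves outward past
  \<open>S\<close>, and \<open>T S S\<close> collapses to \<open>S\<close>.\<close>

lemma is_gD_inverseD:
  assumes "is_gD_inverse T S"
  shows "bounded_clinear T" "bounded_clinear S" "S (T x) = T (S x)" "T (S (S x)) = S x"
    "quasinilpotent (\<lambda>x. T x - T (T (S x)))"
  using assms by (auto simp: is_gD_inverse_def fun_eq_iff o_def)

text \<open>Both intertwining identities use that \<open>1 - T R\<close> is idempotent and commutes
  with \<open>T\<close>, with \<open>N = T (1 - T R)\<close>. Since \<open>S\<close> and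
  \<open>R\<close> are not known to commute, the two orders of the product are treated
  separately.\<close>

lemma is_gD_inverse_idem_absorb:
  assumes S: "is_gD_inverse T S" and R: "is_gD_inverse T R"
  shows "T (T (S (R x))) = T (S x)" "T (T (R (S x))) = T (S x)"
proof -
  note s = is_gD_inverseD[OF S] and r = is_gD_inverseD[OF R]
  note lin = bounded_clinear_diff[OF s(1)] bounded_clinear_diff[OF s(2)] bounded_clinear_diff[OF r(2)]
    bounded_clinear_zero[OF s(1)] bounded_clinear_zero[OF s(2)] bounded_clinear_zero[OF r(2)]
  \<comment> \<open>In these mixed words \<open>T\<close> must move inward past one inverse before
    it cancels against the other, against the direction of the rewrite rules.\<close>
  have absorb: "T (S (R (R y))) = S (R y)" "T (R (S (S y))) = R (S y)" for y
    by (metis s(3) r(4)) (metis r(3) s(4))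
  have "bounded_clinear (\<lambda>x. T (S x) - T (T (S (R x))))"
    by (intro bounded_clinear_sub bounded_clinear_comp[OF s(1)] bounded_clinear_comp[OF s(2)] s r)
  then have "T (S x) - T (T (S (R x))) = 0"
    by (rule intertwiner_eq_0_left[OF r(5) s(2)]) (simp add: lin s(3,4) r(3,4) absorb)
  then show "T (T (S (R x))) = T (S x)" by simp
  have "bounded_clinear (\<lambda>x. T (S x) - T (T (R (S x))))"
    by (intro bounded_clinear_sub bounded_clinear_comp[OF s(1)] bounded_clinear_comp[OF r(2)] s)
  then have "T (S x) - T (T (R (S x))) = 0"
    by (rule intertwiner_eq_0_right[OF r(5) s(2)]) (simp add: lin s(3,4) r(3,4) absorb)
  then show "T (T (R (S x))) = T (S x)" by simp
qed

lemma is_gD_inverse_unique: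
  assumes S: "is_gD_inverse T S" and R: "is_gD_inverse T R"
  shows "S = R"
proof
  fix x
  note s = is_gD_inverseD[OF S] and r = is_gD_inverseD[OF R]
  \<comment> \<open>Both instances evaluate the same word \<open>T T R S\<close>: one gives
    \<open>T S\<close>, the other, with the roles exchanged, \<open>T R\<close>.\<close>
  have idem_eq: "T (S y) = T (R y)" for y
    by (rule trans[OF sym[OF is_gD_inverse_idem_absorb(2)[OF S R]] is_gD_inverse_idem_absorb(1)[OF R S]])
  have "S x = S (T (R x))" by (simp add: s(3,4) flip: idem_eq)
  also have "\<dots> = R x" by (simp add: s(3) r(4) idem_eq)
  finally show "S x = R x" .
qed

lemma gD_inv_eq: "is_gD_inverse T S \<Longrightarrow> gD_inv T = S"
  unfolding gD_inv_def by (rule the_equality) (auto intro: is_gD_inverse_unique)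

section \<open>Generalized Drazin inverses of squares and group inverses\<close>

text \<open>On the zero space every operator is invertible and the spectrum is empty instead of
  \<open>{0}\<close>; hence the nonzero vector.\<close>

lemma quasinilpotent_zero:
  assumes "(x :: 'a::complex_hilbert) \<noteq> 0"
  shows "quasinilpotent (\<lambda>_ :: 'a. 0)"
proof -
  have "\<not> invertible_op (\<lambda>_ :: 'a. 0)"
    using assms by (auto simp: invertible_op_def fun_eq_iff)
  moreover have "invertible_op (\<lambda>y :: 'a. 0 - z *\<^sub>C y)" if "z \<noteq> 0" for z
    unfolding invertible_op_def
    using that
    by (intro conjI exI[of _ "\<lambda>y. (- 1 / z) *\<^sub>C y"] bounded_clinear_sub
        bounded_clinear_const_zero bounded_clinear_scaleC_const) (simp_all add: fun_eq_iff scaleC_one)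
  ultimately show ?thesis
    by (auto simp: quasinilpotent_def spectrum_op_def bounded_clinear_const_zero)
qed

text \<open>If \<open>Q\<close> inverts \<open>N^2\<close>, then \<open>Q N\<close> inverts
  \<open>N\<close>, so 0 stays in the spectrum. For \<open>z = w^2 \<noteq> 0\<close> the
  factorization \<open>N^2 - z = (N - w) (N + w)\<close> has invertible factors.\<close>

lemma quasinilpotent_square:
  assumes "quasinilpotent N"
  shows "quasinilpotent (\<lambda>x. N (N x))"
proof -
  have N: "bounded_clinear N" and spec: "spectrum_op N = {0}"
    using assms by (auto simp: quasinilpotent_def)
  have NN: "bounded_clinear (\<lambda>x. N (N x))" by (rule bounded_clinear_comp[OF N N])
  have "\<not> invertible_op (\<lambda>x. N (N x))"
  proof
    assume "invertible_op (\<lambda>x. N (N x))"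
    then obtain Q where Q: "bounded_clinear Q" "\<And>x. N (N (Q x)) = x" "\<And>x. Q (N (N x)) = x"
      unfolding invertible_op_iff by blast
    have "N (Q (N x)) = x" for x
    proof -
      have "N (Q (N x)) = N (Q (N (N (N (Q x)))))" by (simp only: Q(2))
      also have "\<dots> = N (N (Q x))" by (simp only: Q(3))
      finally show ?thesis by (simp only: Q(2))
    qed
    then have "invertible_op N"
      unfolding invertible_op_iff using N Q bounded_clinear_comp[OF Q(1) N] by metis
    then have "0 \<notin> spectrum_op N" by (simp add: spectrum_op_def)
    then show False using spec by simp
  qed
  moreover have "invertible_op (\<lambda>x. N (N x) - z *\<^sub>C x)" if "z \<noteq> 0" for z
  proof -
    define w where "w = csqrt z"
    have w: "w * w = z" "w \<noteq> 0" using that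
      by (auto simp: w_def power2_csqrt power2_eq_square[symmetric])
    have "w \<notin> spectrum_op N" "- w \<notin> spectrum_op N" using spec w by auto
    then have "invertible_op (\<lambda>x. N x - w *\<^sub>C x)" "invertible_op (\<lambda>x. N x - (- w) *\<^sub>C x)"
      unfolding spectrum_op_def by blast+
    then obtain P Q where P: "bounded_clinear P" "\<And>x. N (P x) - w *\<^sub>C P x = x"
        "\<And>x. P (N x - w *\<^sub>C x) = x"
      and Q: "bounded_clinear Q" "\<And>x. N (Q x) - (- w) *\<^sub>C Q x = x"
        "\<And>x. Q (N x - (- w) *\<^sub>C x) = x"
      unfolding invertible_op_iff by blast
    \<comment> \<open>\<open>N + w\<close> is spelled \<open>N - (- w)\<close> to match the
      operators in \<open>spectrum_op\<close>.\<close>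
    have factor: "N (N x) - z *\<^sub>C x = N (N x - (- w) *\<^sub>C x) - w *\<^sub>C (N x - (- w) *\<^sub>C x)" for x
      by (simp add: bounded_clinear_diff[OF N] bounded_clinear_add[OF N] bounded_clinear_minus[OF N]
          bounded_clinear_scaleC[OF N] scaleC_add_right w(1))
    show ?thesis
      unfolding invertible_op_iff factor
    proof (intro conjI exI[of _ "\<lambda>x. Q (P x)"])
      show "bounded_clinear (\<lambda>x. N (N x - - w *\<^sub>C x) - w *\<^sub>C (N x - - w *\<^sub>C x))"
        unfolding factor [symmetric] by (intro bounded_clinear_sub NN bounded_clinear_scaleC_const)
      show "bounded_clinear (\<lambda>x. Q (P x))" by (rule bounded_clinear_comp[OF Q(1) P(1)])
    qed (simp_all only: P Q simp_thms)
  qed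
  ultimately show ?thesis
    using NN by (auto simp: quasinilpotent_def spectrum_op_def)
qed

text \<open>The quasinilpotent part of \<open>T^2\<close> is the square of that of \<open>T\<close>,
  because \<open>1 - T S\<close> is an idempotent commuting with \<open>T\<close>.\<close>

lemma is_gD_inverse_square:
  assumes "is_gD_inverse T S"
  shows "is_gD_inverse (\<lambda>x. T (T x)) (\<lambda>x. S (S x))"
proof -
  note s = is_gD_inverseD[OF assms]
  have "quasinilpotent (\<lambda>x. T (T x) - T (T (T (T (S (S x))))))"
    using quasinilpotent_square[OF s(5)]
    by (simp add: bounded_clinear_diff[OF s(1)] bounded_clinear_diff[OF s(2)]
        bounded_clinear_zero[OF s(1)] s(3,4))
  then show ?thesis
    unfolding is_gD_inverse_def o_def fun_eq_iff
    by (intro conjI bounded_clinear_comp[OF s(1) s(1)] bounded_clinear_comp[OF s(2) s(2)])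
      (simp_all add: s(3,4))
qed

lemma group_inverse_is_gD_inverse:
  fixes T S :: "'a::complex_hilbert \<Rightarrow> 'a"
  assumes "(v :: 'a) \<noteq> 0" "bounded_clinear T" "bounded_clinear S"
    "\<And>x. T (S x) = S (T x)" "\<And>x. S (T (S x)) = S x" "\<And>x. T (T (S x)) = T x"
  shows "is_gD_inverse T S"
  using assms quasinilpotent_zero[OF assms(1)] by (simp add: is_gD_inverse_def fun_eq_iff)

lemma group_invertibleI:
  assumes "is_gD_inverse T S" "\<And>x. T (T (S x)) = T x"
  shows "group_invertible T"
  using assms gD_inv_eq[OF assms(1)] by (auto simp: group_invertible_def gD_invertible_def fun_eq_iff)

section \<open>The core-EP inverse\<close>

text \<open>\<open>range S\<close> is the fixed space of the bounded operator \<open>T S\<close>,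
  hence a closed subspace, so its orthogonal projector exists.\<close>

lemma orth_proj_gD_range:
  assumes "is_gD_inverse T S"
  shows "bounded_clinear (orth_proj (range S))" "T (S (orth_proj (range S) x)) = orth_proj (range S) x"
    "orth_proj (range S) (S x) = S x"
proof -
  note s = is_gD_inverseD[OF assms]
  have L: "range S = {x. T (S x) = x}" by (auto simp: s(4) image_iff) (metis s(3))
  have cont: "continuous_on UNIV (\<lambda>x. T (S x))"
    using bounded_clinear_bounded_linear[OF bounded_clinear_comp[OF s(1,2)]]
    by (simp add: linear_continuous_on)
  have "closed (range S)"
    unfolding L by (rule closed_Collect_eq[OF cont continuous_on_id])
  moreover have "scaleC.subspace (range S)"
    unfolding L
    by (rule scaleC.subspaceI)
      (simp_all add: bounded_clinear_zero[OF s(1)] bounded_clinear_zero[OF s(2)]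
        bounded_clinear_add[OF s(1)] bounded_clinear_add[OF s(2)]
        bounded_clinear_scaleC[OF s(1)] bounded_clinear_scaleC[OF s(2)])
  ultimately have P: "is_proj_along (orth_proj (range S)) (range S) (orth_compl (range S))"
    by (intro is_proj_along_orth_proj)
  then show "bounded_clinear (orth_proj (range S))" by (simp add: is_proj_along_def)
  have "orth_proj (range S) x \<in> range S" for x using P by (auto simp: is_proj_along_def)
  then show "T (S (orth_proj (range S) x)) = orth_proj (range S) x" unfolding L by blast
  have "S x \<in> range (orth_proj (range S))" using P by (auto simp: is_proj_along_def)
  then show "orth_proj (range S) (S x) = S x"
    using P unfolding is_proj_along_def fun_eq_iff o_def by (metis rangeE)
qed

lemma cEP_inv_eq:
  assumes "is_gD_inverse T S"
  shows "cEP_inv T = S \<circ> orth_proj (range S)"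
  unfolding cEP_inv_def gD_inv_eq[OF assms]
proof (rule the_equality)
  note s = is_gD_inverseD[OF assms] and p = orth_proj_gD_range[OF assms]
  show "bounded_clinear (S \<circ> orth_proj (range S)) \<and>
      T \<circ> (S \<circ> orth_proj (range S)) = orth_proj (range S) \<and>
      range (S \<circ> orth_proj (range S)) \<subseteq> range S"
    using p s by (auto simp: o_def fun_eq_iff intro: bounded_clinear_comp[OF s(2) p(1)])
  fix B
  assume B: "bounded_clinear B \<and> T \<circ> B = orth_proj (range S) \<and> range B \<subseteq> range S"
  have "B x = S (orth_proj (range S) x)" for x
  proof -
    obtain y where y: "B x = S y" using B by blast
    \<comment> \<open>Applying \<open>S\<close> to \<open>T B = P\<close> recovers \<open>B\<close>,
      because \<open>S T\<close> fixes \<open>range S\<close>.\<close>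
    have "S (orth_proj (range S) x) = S (T (B x))" using B by (auto simp: fun_eq_iff)
    then show ?thesis by (simp add: y s(3,4))
  qed
  then show "B = S \<circ> orth_proj (range S)" by auto
qed

section \<open>Representations of the weak group inverse\<close>

theorem corollary2p5:
  fixes A :: "'a::complex_hilbert \<Rightarrow> 'a"
  assumes infinite_dim: "\<not> (\<exists>S::'a set. finite S \<and> module.span scaleC S = UNIV)"
    and bounded: "bounded_clinear A"
    and gD: "gD_invertible A"
  shows
    \<comment> \<open>the idempotent and the core-EP inverse of the square occurring below exist\<close>
    "(\<exists>P. is_proj_along P (range (gD_inv A)) (null_space (cEP_inv A \<circ> A))) \<and>
     gD_invertible (A ^^ 2) \<and>
     \<comment> \<open>(i)\<close>
     weak_group_inv A =
       cEP_inv A \<circ> proj_along (range (gD_inv A)) (null_space (cEP_inv A \<circ> A)) \<and>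
     \<comment> \<open>(ii)\<close>
     weak_group_inv A =
       gD_inv A \<circ> proj_along (range (gD_inv A)) (null_space (cEP_inv A \<circ> A)) \<and>
     \<comment> \<open>(iii)\<close>
     (group_invertible (A \<circ> cEP_inv A \<circ> A) \<and>
      weak_group_inv A = group_inv (A \<circ> cEP_inv A \<circ> A) \<and>
      group_inv (A \<circ> cEP_inv A \<circ> A) = group_inv (orth_proj (range (gD_inv A)) \<circ> A)) \<and>
     \<comment> \<open>(iv)\<close>
     (weak_group_inv A = cEP_inv (A ^^ 2) \<circ> A \<circ> cEP_inv A \<circ> A \<and>
      cEP_inv (A ^^ 2) \<circ> A \<circ> cEP_inv A \<circ> A =
        cEP_inv (A ^^ 2) \<circ> A \<circ>
          proj_along (range (gD_inv A)) (null_space (cEP_inv A \<circ> A))) \<and>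
     \<comment> \<open>(v)\<close>
     weak_group_inv A = (gD_inv A ^^ 2) \<circ> orth_proj (range (gD_inv A)) \<circ> A \<and>
     \<comment> \<open>(vi)\<close>
     weak_group_inv A = cEP_inv (A ^^ 2) \<circ> A \<and>
     \<comment> \<open>(vii)\<close>
     (group_invertible ((A ^^ 3) \<circ> gD_inv A) \<and>
      weak_group_inv A = core_inv ((A ^^ 3) \<circ> gD_inv A) \<circ> A \<circ> cEP_inv A \<circ> A \<and>
      core_inv ((A ^^ 3) \<circ> gD_inv A) \<circ> A \<circ> cEP_inv A \<circ> A =
        core_inv ((A ^^ 3) \<circ> gD_inv A) \<circ> A)"
proof -
  define D where "D = gD_inv A"
  have gdA: "is_gD_inverse A D"
    using gD gD_inv_eq by (auto simp: gD_invertible_def D_def)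
  define P where "P = orth_proj (range D)"
  note d = is_gD_inverseD[OF gdA] and p = orth_proj_gD_range[OF gdA, folded P_def]
  have cEP: "cEP_inv A = D \<circ> P" using cEP_inv_eq[OF gdA] by (simp add: P_def)
  \<comment> \<open>\<open>A\<close> maps the range of \<open>D\<close> into itself since it
    commutes with \<open>D\<close>, and \<open>P\<close> fixes that range.\<close>
  have PAP: "P (A (P x)) = A (P x)" for x
    by (metis d(3) p(2,3))
  have PAD: "P (A (D x)) = A (D x)" for x
    by (metis d(3) p(3))
  have ADP: "A (D (P x)) = P x" for x by (rule p(2))
  have PP: "P (P x) = P x" for x by (metis PAD ADP)
  note simps = d(3,4) ADP PP PAD PAP p(3)
  \<comment> \<open>The zero space is spanned by the empty set. The vector is needed for the zero
    operator to have spectrum \<open>{0}\<close>.\<close>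
  obtain v :: 'a where v: "v \<noteq> 0"
  proof (rule ccontr)
    assume "\<not> thesis"
    then have "x = 0" for x :: 'a using that by blast
    then have "scaleC.span {} = (UNIV :: 'a set)" by auto
    then show False using infinite_dim by blast
  qed
  have PA: "bounded_clinear (\<lambda>x. P (A x))" by (rule bounded_clinear_comp[OF p(1) d(1)])
  have DPA: "bounded_clinear (\<lambda>x. D (P (A x)))" by (rule bounded_clinear_comp[OF d(2) PA])
  have DDPA: "bounded_clinear (\<lambda>x. D (D (P (A x))))" by (rule bounded_clinear_comp[OF d(2) DPA])
  have AAAD: "bounded_clinear (\<lambda>x. A (A (A (D x))))"
    by (rule bounded_clinear_comp[OF d(1) bounded_clinear_comp[OF d(1) bounded_clinear_comp[OF d(1,2)]]])
  have DD: "bounded_clinear (\<lambda>x. D (D x))" by (rule bounded_clinear_comp[OF d(2) d(2)])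
  have W: "weak_group_inv A = (\<lambda>x. D (D (P (A x))))"
    by (simp add: weak_group_inv_def cEP fun_eq_iff numeral_2_eq_2 simps)
  \<comment> \<open>The idempotent of the statement is \<open>cEP_inv A \<circ> A = D P A\<close>
    itself: \<open>A D P = P\<close> makes it idempotent, and \<open>D = D P A D\<close> gives its
    range.\<close>
  have "is_proj_along (\<lambda>x. D (P (A x))) (range D) (null_space (\<lambda>x. D (P (A x))))"
    unfolding is_proj_along_def
  proof (intro conjI refl)
    show "bounded_clinear (\<lambda>x. D (P (A x)))" by (rule DPA)
    show "(\<lambda>x. D (P (A x))) \<circ> (\<lambda>x. D (P (A x))) = (\<lambda>x. D (P (A x)))"
      by (simp add: fun_eq_iff simps)
    have "D x = D (P (A (D x)))" for x by (simp add: simps)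
    then show "range (\<lambda>x. D (P (A x))) = range D" by blast
  qed
  moreover have "cEP_inv A \<circ> A = (\<lambda>x. D (P (A x)))" by (simp add: cEP fun_eq_iff)
  ultimately have proj: "is_proj_along (\<lambda>x. D (P (A x))) (range D) (null_space (cEP_inv A \<circ> A))"
    by simp
  note Q = proj_along_eq[OF proj]
  have A2: "A ^^ 2 = (\<lambda>x. A (A x))" "D ^^ 2 = (\<lambda>x. D (D x))"
    by (simp_all add: fun_eq_iff numeral_2_eq_2)
  have gdA2: "is_gD_inverse (A ^^ 2) (\<lambda>x. D (D x))"
    unfolding A2 by (rule is_gD_inverse_square[OF gdA])
  \<comment> \<open>Equal ranges of \<open>D^2\<close> and \<open>D\<close> mean that the core-EP
    inverses below involve the same projector \<open>P\<close>.\<close>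
  have "D x = D (D (A x))" for x by (simp add: simps)
  then have range_DD: "range (\<lambda>x. D (D x)) = range D" by blast
  have cEP2: "cEP_inv (A ^^ 2) = (\<lambda>x. D (D (P x)))"
    using cEP_inv_eq[OF gdA2] by (simp add: range_DD P_def fun_eq_iff)
  have ABA: "A \<circ> cEP_inv A \<circ> A = (\<lambda>x. P (A x))" by (simp add: cEP fun_eq_iff simps)
  \<comment> \<open>The group inverse exhibited here is literally the word for the weak group
    inverse in \<open>W\<close>, which is (iii).\<close>
  have gdPA: "is_gD_inverse (\<lambda>x. P (A x)) (\<lambda>x. D (D (P (A x))))"
    by (rule group_inverse_is_gD_inverse[OF v])
      (simp_all add: simps PA DDPA)
  have grPA: "group_invertible (\<lambda>x. P (A x))"
    by (rule group_invertibleI[OF gdPA]) (simp add: simps)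
  have A3D: "(A ^^ 3) \<circ> D = (\<lambda>x. A (A (A (D x))))" by (simp add: fun_eq_iff numeral_3_eq_3)
  \<comment> \<open>\<open>A^3 D\<close> is \<open>A^2\<close> times the idempotent
    \<open>A D\<close>, so only the part of \<open>A^2\<close> on the range of \<open>D\<close>
    remains, with inverse \<open>D^2\<close> there.\<close>
  have gdA3: "is_gD_inverse (\<lambda>x. A (A (A (D x)))) (\<lambda>x. D (D x))"
    by (rule group_inverse_is_gD_inverse[OF v])
      (simp_all add: simps AAAD DD)
  have grA3: "group_invertible (\<lambda>x. A (A (A (D x))))"
    by (rule group_invertibleI[OF gdA3]) (simp add: simps)
  \<comment> \<open>This is the same operator as in \<open>cEP2\<close>, so (vii) repeats the word
    computations of (iv) and (vi).\<close>
  have core: "core_inv (\<lambda>x. A (A (A (D x)))) = (\<lambda>x. D (D (P x)))"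
    using cEP_inv_eq[OF gdA3] by (simp add: core_inv_def range_DD P_def fun_eq_iff)
  show ?thesis
    unfolding D_def [symmetric] P_def [symmetric] Q W A3D ABA core cEP2 group_inv_def
    using proj gdA2 grPA grA3
    by (auto simp: cEP A2 gD_inv_eq[OF gdPA] gD_invertible_def fun_eq_iff simps o_def)
qed

end
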